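(* Let $\mathcal{M}\subseteq\mathcal{E}$ be a smooth embedded Riemannian submanifold of a Euclidean space $\mathcal{E}$ with retraction $\mathrm{R}:T\mathcal{M}\to\mathcal{M}$, and let $\varphi:\mathcal{M}\to\mathbb{R}$ be continuous with $\inf_{x\in\mathcal{M}}\varphi(x)>-\infty$. Assume that $\partial_{\mathcal{M}}\varphi$ is locally bounded and that for all $\bar x\in\mathcal{M}$ there exist $\tilde\kappa>0$, $r>0$ and an open neighborhood $V\subseteq\mathcal{M}$ of $\bar x$ with $$\varphi(\mathrm{R}_x(\xi_x))-\big(\varphi(x)+\langle w,\xi_x\rangle\big)\le\tilde\kappa\|\xi_x\|^2$$ for all $x\in V$, all $\xi_x\in T_x\mathcal{M}$ with $\|\xi_x\|\le r$ and all $w\in\partial_{\mathcal{M}}\varphi(x)$. Run the nonmonotone subgradient method (described in the context) from an arbitrary $x^0\in\mathcal{M}$, where for constants $a,b>0$ independent of $k$ the chosen $w^k_{\mathcal{M}}\in\partial_{\mathcal{M}}\varphi(x^k)$ and $d^k\in T_{x^k}\mathcal{M}$ satisfy $\langle w^k_{\mathcal{M}},d^k\rangle\le-a\|d^k\|^2$ and $\|w^k_{\mathcal{M}}\|\le b\|d^k\|$ for all $k$. Then either the method stops at a stationary point after a finite number of iterations, or the following assertions hold for the generated sequence $\{x^k\}$: 1. If $\{x^k\}_{k\in K}$ is a bounded subsequence of $\{x^k\}$, then the corresponding (accepted) stepsizes are uniformly bounded away from zero, i.e. $\inf_{k\in K}\tau_k>0$. Further, $\|w^k_{\mathcal{M}}\|\to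 0$ and $\|d^k\|\to 0$ as $k\to\infty$, $k\in K$. 2. Any accumulation point of $\{x^k\}_{k\in\mathbb{N}}$ is a stationary point of $\varphi$ with respect to $\mathcal{M}$. 3. If $x^*$ is an accumulation point of $\{x^k\}$, then the entire sequence $\{\varphi(x^k)\}$ converges to $\varphi(x^* )$ and the sequence $\{\mathcal{R}_k\}$ of reference values converges monotonically to $\varphi(x^* )$.
   Context: $\mathcal{E}$ is a Euclidean space (finite-dimensional real Hilbert space) with inner product $\langle\cdot,\cdot\rangle$ and norm $\|\cdot\|$; $\overline{\mathbb{R}}=(-\infty,+\infty]$. Smooth embedded submanifold: $\mathcal{M}\subseteq\mathcal{E}$ such that around each $\bar x\in\mathcal{M}$ there are an open neighborhood $U\subseteq\mathcal{E}$ and a $\mathcal{C}^1$ map $F:U\to\mathbb{R}^m$ with $\nabla F(\bar x)$ of rank $m$ ($m=\dim\mathcal{E}-\dim\mathcal{M}$) and $\mathcal{M}\cap U=\{x\in U:F(x)=0\}$. $T_x\mathcal{M}=\ker DF(x)\subseteq\mathcal{E}$ carries the inner product inherited from $\mathcal{E}$; $T\mathcal{M}=\{(x,\xi):x\in\mathcal{M},\xi\in T_x\mathcal{M}\}$. Retraction: a map $\mathrm{R}:T\mathcal{M}\to\mathcal{M}$, globally defined and at least $\mathcal{C}^2$ (locally the restriction of a $\mathcal{C}^2$ map on an open subset of $\mathcal{E}\times\mathcal{E}$), such that $\mathrm{R}_x:=\mathrm{R}(x,\cdot)$ satisfies $\mathrm{R}_x(0_x)=x$ and $D\mathrm{R}_x(0_x)=\mathrm{id}_{T_x\mathcal{M}}$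 for all $x\in\mathcal{M}$. Subdifferentials: for $g:\mathcal{E}\to\overline{\mathbb{R}}$ and $g(x)<\infty$, $\hat\partial g(x)=\{v:\liminf_{y\to x,y\ne x}\frac{g(y)-g(x)-\langle v,y-x\rangle}{\|y-x\|}\ge0\}$, and $\partial g(x)$ is the set of limits $v=\lim v^k$ with $v^k\in\hat\partial g(x^k)$, $x^k\to x$, $g(x^k)\to g(x)$. With $\delta_{\mathcal{M}}$ the indicator function of $\mathcal{M}$, and $\varphi+\delta_{\mathcal{M}}$ equal to $\varphi$ on $\mathcal{M}$ and $+\infty$ elsewhere, the projectional subdifferential is $\partial_{\mathcal{M}}\varphi(x)=\mathrm{proj}_{T_x\mathcal{M}}\partial(\varphi+\delta_{\mathcal{M}})(x)=\partial(\varphi+\delta_{\mathcal{M}})(x)\cap T_x\mathcal{M}$ for $x\in\mathcal{M}$. It is locally bounded if each point of $\mathcal{M}$ has a neighborhood $V$ in $\mathcal{M}$ with $\bigcup_{x\in V}\partial_{\mathcal{M}}\varphi(x)$ bounded. A point $x^*\in\mathcal{M}$ is stationary if $0\in\partial_{\mathcal{M}}\varphi(x^* )$. Accumulation points of sequences in $\mathcal{M}$ are understood to be points of $\mathcal{M}$. Nonmonotone subgradient method. Parameters: $x^0\in\mathcal{M}$, $0<\tau_{\min}\le\tau_{\max}<\infty$, $\sigma,\beta\in(0,1)$, $p_{\min}\in(0,1]$. Set $\mathcal{R}_0:=\varphi(x^0)$. For $k=0,1,2,\dots$: choose $w^k_{\mathcal{M}}\in\partial_{\mathcal{M}}\varphi(x^k)$;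 if $w^k_{\mathcal{M}}=0$, stop and return $x^k$. Otherwise choose $d^k\in T_{x^k}\mathcal{M}\setminus\{0\}$ satisfying $\langle w^k_{\mathcal{M}},d^k\rangle\le-a\|d^k\|^2$ and $\|w^k_{\mathcal{M}}\|\le b\|d^k\|$. Choose an initial $\tau_k\in[\tau_{\min},\tau_{\max}]$; while $\varphi(\mathrm{R}_{x^k}(\tau_kd^k))>\mathcal{R}_k+\sigma\tau_k\langle w^k_{\mathcal{M}},d^k\rangle$, replace $\tau_k$ by $\beta\tau_k$. With the accepted $\tau_k$ set $x^{k+1}:=\mathrm{R}_{x^k}(\tau_kd^k)$. Choose $p_{k+1}\in[p_{\min},1]$ and set $\mathcal{R}_{k+1}:=(1-p_{k+1})\mathcal{R}_k+p_{k+1}\varphi(x^{k+1})$.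
   Formalization: In assertion 1 the bounded subsequence is also required to have all its accumulation points in M (automatic if M is closed); otherwise it fails, e.g. M=(0,∞), R_x(ξ)=x·exp(ξ/x), φ(x)=x, w=1, d=−1, where x^k→0 and τ_k→0. *)

theory Defs
  imports "HOL-Analysis.Analysis" "HOL-Library.While_Combinator"
begin

(* A C^1 map F : U -> R^m is given by its components F i (i < m) with continuous gradients G i;
   the rank of its derivative at x is the dimension of the span of the gradients. *)
definition local_defining_map ::
  "'a::euclidean_space set \<Rightarrow> 'a \<Rightarrow> nat \<Rightarrow> 'a set \<Rightarrow> (nat \<Rightarrow> 'a \<Rightarrow> real) \<Rightarrow> (nat \<Rightarrow> 'a \<Rightarrow> 'a) \<Rightarrow> bool"
  where "local_defining_map M x m U F G \<longleftrightarrow>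
    open U \<and> x \<in> M \<inter> U \<and>
    (\<forall>i<m. (\<forall>y\<in>U. GDERIV (F i) y :> G i y) \<and> continuous_on U (G i)) \<and>
    dim ((\<lambda>i. G i x) ` {..<m}) = m \<and>
    M \<inter> U = {y \<in> U. \<forall>i<m. F i y = 0}"

definition embedded_submanifold :: "nat \<Rightarrow> 'a::euclidean_space set \<Rightarrow> bool"
  where "embedded_submanifold n M \<longleftrightarrow>
    n \<le> DIM('a) \<and> (\<forall>x\<in>M. \<exists>U F G. local_defining_map M x (DIM('a) - n) U F G)"

(* The kernel of DF(x); it does not depend on the local defining map F. *)
definition tangent_space :: "'a::euclidean_space set \<Rightarrow> 'a \<Rightarrow> 'a set"
  where "tangent_space M x =
    {\<xi>. \<exists>m U F G. local_defining_map M x m U F G \<and> (\<forall>i<m. G i x \<bullet> \<xi> = 0)}"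

definition tangent_bundle :: "'a::euclidean_space set \<Rightarrow> ('a \<times> 'a) set"
  where "tangent_bundle M = Sigma M (tangent_space M)"

definition C2_on :: "'a::real_normed_vector set \<Rightarrow> ('a \<Rightarrow> 'b::real_normed_vector) \<Rightarrow> bool"
  where "C2_on W f \<longleftrightarrow>
    (\<exists>(f' :: 'a \<Rightarrow> 'a \<Rightarrow>\<^sub>L 'b) (f'' :: 'a \<Rightarrow> 'a \<Rightarrow>\<^sub>L ('a \<Rightarrow>\<^sub>L 'b)).
      (\<forall>z\<in>W. (f has_derivative blinfun_apply (f' z)) (at z) \<and>
              (f' has_derivative blinfun_apply (f'' z)) (at z)) \<and>
      continuous_on W f'')"

(* R is a total function, but only its values on the tangent bundle matter. *)
definition retraction_on :: "'a::euclidean_space set \<Rightarrow> ('a \<times> 'a \<Rightarrow> 'a) \<Rightarrow> bool"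
  where "retraction_on M R \<longleftrightarrow>
    R ` tangent_bundle M \<subseteq> M \<and>
    (\<forall>z\<in>tangent_bundle M. \<exists>W S. open W \<and> z \<in> W \<and> C2_on W S \<and>
        (\<forall>z'\<in>W \<inter> tangent_bundle M. R z' = S z')) \<and>
    (\<forall>x\<in>M. R (x, 0) = x \<and>
        ((\<lambda>\<xi>. R (x, \<xi>)) has_derivative (\<lambda>\<xi>. \<xi>)) (at 0 within tangent_space M x))"

definition frechet_subdifferential :: "('a::euclidean_space \<Rightarrow> ereal) \<Rightarrow> 'a \<Rightarrow> 'a set"
  where "frechet_subdifferential g x =
    {v. \<bar>g x\<bar> \<noteq> \<infinity> \<and>
        0 \<le> Liminf (at x) (\<lambda>y. (g y - g x - ereal (v \<bullet> (y - x))) / ereal (norm (y - x)))}"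

definition limiting_subdifferential :: "('a::euclidean_space \<Rightarrow> ereal) \<Rightarrow> 'a \<Rightarrow> 'a set"
  where "limiting_subdifferential g x =
    {v. \<bar>g x\<bar> \<noteq> \<infinity> \<and>
        (\<exists>y u. (\<forall>k::nat. u k \<in> frechet_subdifferential g (y k)) \<and>
               y \<longlonglongrightarrow> x \<and> (\<lambda>k. g (y k)) \<longlonglongrightarrow> g x \<and> u \<longlonglongrightarrow> v)}"

(* phi + delta_M *)
definition plus_indicator :: "('a \<Rightarrow> real) \<Rightarrow> 'a set \<Rightarrow> 'a \<Rightarrow> ereal"
  where "plus_indicator \<phi> M x = (if x \<in> M then ereal (\<phi> x) else \<infinity>)"

(* On a linear subspace, closest_point is the orthogonal projection. *)
definition projectional_subdifferential ::
  "'a::euclidean_space set \<Rightarrow> ('a \<Rightarrow> real) \<Rightarrow> 'a \<Rightarrow> 'a set"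
  where "projectional_subdifferential M \<phi> x =
    closest_point (tangent_space M x) ` limiting_subdifferential (plus_indicator \<phi> M) x"

definition locally_bounded_on :: "'a::euclidean_space set \<Rightarrow> ('a \<Rightarrow> 'a set) \<Rightarrow> bool"
  where "locally_bounded_on M S \<longleftrightarrow>
    (\<forall>x\<in>M. \<exists>V. openin (top_of_set M) V \<and> x \<in> V \<and> bounded (\<Union>y\<in>V. S y))"

definition stationary_point :: "'a::euclidean_space set \<Rightarrow> ('a \<Rightarrow> real) \<Rightarrow> 'a \<Rightarrow> bool"
  where "stationary_point M \<phi> x \<longleftrightarrow> x \<in> M \<and> 0 \<in> projectional_subdifferential M \<phi> x"

definition accumulation_point :: "(nat \<Rightarrow> 'a::topological_space) \<Rightarrow> 'a \<Rightarrow> bool"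
  where "accumulation_point y z \<longleftrightarrow> (\<exists>s. strict_mono s \<and> (y \<circ> s) \<longlonglongrightarrow> z)"

(* The result is None if the backtracking loop does not terminate. *)
definition line_search ::
  "('a::euclidean_space \<times> 'a \<Rightarrow> 'a) \<Rightarrow> ('a \<Rightarrow> real) \<Rightarrow> real \<Rightarrow> real \<Rightarrow>
    'a \<Rightarrow> 'a \<Rightarrow> 'a \<Rightarrow> real \<Rightarrow> real \<Rightarrow> real option"
  where "line_search R \<phi> \<sigma> \<beta> x w d r t0 =
    while_option (\<lambda>t. \<phi> (R (x, t *\<^sub>R d)) > r + \<sigma> * t * (w \<bullet> d)) (\<lambda>t. \<beta> * t) t0"

(* Iteration k is entered: no earlier iteration stopped the method or got stuck in its line search.
   Here r k is the k-th reference value and t0 k the initial trial stepsize. *)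
definition reached ::
  "('a::euclidean_space \<times> 'a \<Rightarrow> 'a) \<Rightarrow> ('a \<Rightarrow> real) \<Rightarrow> real \<Rightarrow> real \<Rightarrow>
    (nat \<Rightarrow> 'a) \<Rightarrow> (nat \<Rightarrow> 'a) \<Rightarrow> (nat \<Rightarrow> 'a) \<Rightarrow> (nat \<Rightarrow> real) \<Rightarrow> (nat \<Rightarrow> real) \<Rightarrow> nat \<Rightarrow> bool"
  where "reached R \<phi> \<sigma> \<beta> x w d r t0 k \<longleftrightarrow>
    (\<forall>j<k. w j \<noteq> 0 \<and> line_search R \<phi> \<sigma> \<beta> (x j) (w j) (d j) (r j) (t0 j) \<noteq> None)"

(* The sequences record the choices and results of a run of the method.  Their values are
   constrained only as far as the run gets; in particular, termination of the line search
   is not assumed. *)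
definition nonmonotone_subgradient_run ::
  "'a::euclidean_space set \<Rightarrow> ('a \<times> 'a \<Rightarrow> 'a) \<Rightarrow> ('a \<Rightarrow> real) \<Rightarrow>
    real \<Rightarrow> real \<Rightarrow> real \<Rightarrow> real \<Rightarrow> real \<Rightarrow> real \<Rightarrow> real \<Rightarrow>
    (nat \<Rightarrow> 'a) \<Rightarrow> (nat \<Rightarrow> 'a) \<Rightarrow> (nat \<Rightarrow> 'a) \<Rightarrow>
    (nat \<Rightarrow> real) \<Rightarrow> (nat \<Rightarrow> real) \<Rightarrow> (nat \<Rightarrow> real) \<Rightarrow> (nat \<Rightarrow> real) \<Rightarrow> bool"
  where "nonmonotone_subgradient_run M R \<phi> \<tau>min \<tau>max \<sigma> \<beta> pmin a b x w d t0 \<tau> p r \<longleftrightarrow>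
    x 0 \<in> M \<and> r 0 = \<phi> (x 0) \<and>
    (\<forall>k. reached R \<phi> \<sigma> \<beta> x w d r t0 k \<longrightarrow>
      w k \<in> projectional_subdifferential M \<phi> (x k) \<and>
      (w k \<noteq> 0 \<longrightarrow>
        d k \<in> tangent_space M (x k) - {0} \<and>
        w k \<bullet> d k \<le> - a * (norm (d k))\<^sup>2 \<and>
        norm (w k) \<le> b * norm (d k) \<and>
        t0 k \<in> {\<tau>min..\<tau>max} \<and>
        (\<forall>t. line_search R \<phi> \<sigma> \<beta> (x k) (w k) (d k) (r k) (t0 k) = Some t \<longrightarrow>
          \<tau> k = t \<and>
          x (Suc k) = R (x k, \<tau> k *\<^sub>R d k) \<and>
          p (Suc k) \<in> {pmin..1} \<and>
          r (Suc k) = (1 - p (Suc k)) * r k + p (Suc k) * \<phi> (x (Suc k)))))"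

end

theory Submission
  imports Defs
begin

text \<open>
  Near each point of \<open>M\<close> the descent inequality together with the local bound on
  \<open>\<partial>\<^sub>M \<phi>\<close> makes every trial stepsize below some \<open>c > 0\<close> acceptable, so the line search terminates
  and accepted stepsizes are locally bounded away from zero; compactness makes this uniform along
  bounded subsequences. The reference values decrease and are bounded below, which forces
  \<open>\<tau>\<^sub>k \<parallel>d\<^sup>k\<parallel>\<^sup>2 \<longlonglongrightarrow> 0\<close> and \<open>\<R>\<^sub>k - \<phi>(x\<^sup>k\<^sup>+\<^sup>1) \<longlonglongrightarrow> 0\<close>.

  Stationarity passes to the limit because the projectional subdifferential is contained in the
  limiting subdifferential of \<open>\<phi> + \<delta>\<^sub>M\<close>, whose graph is closed. For the inclusion, the normal part
  of a limiting subgradient is a combination of the gradients of the defining functions; it extends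
  continuously to nearby points of \<open>M\<close>, where subtracting it preserves regular subgradients
  since the defining functions vanish on \<open>M\<close>.
\<close>

section \<open>Tangent spaces as kernels of local defining maps\<close>

lemma tangent_space_scaleR:
  assumes "\<xi> \<in> tangent_space M x"
  shows "c *\<^sub>R \<xi> \<in> tangent_space M x"
  using assms unfolding tangent_space_def by fastforce

lemma embedded_submanifoldE:
  assumes "embedded_submanifold n M" "x \<in> M"
  obtains m U F G where "local_defining_map M x m U F G"
  using assms unfolding embedded_submanifold_def by blast

lemma zero_in_tangent_space:
  assumes "embedded_submanifold n M" "x \<in> M"
  shows "0 \<in> tangent_space M x"
  using assms by (elim embedded_submanifoldE) (auto simp: tangent_space_def)

text \<open>
  Differentiating \<open>F\<^sub>i (R (x, t \<xi>)) = 0\<close> at \<open>t = 0\<close> gives independence of the kernel of the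
  local defining map without the implicit function theorem.
\<close>
lemma tangent_space_inner_gradient:
  assumes R: "retraction_on M R" and x: "x \<in> M"
    and L: "local_defining_map M x m U F G" and i: "i < m"
    and \<xi>: "\<xi> \<in> tangent_space M x"
  shows "G i x \<bullet> \<xi> = 0"
proof -
  define \<gamma> where "\<gamma> = (\<lambda>t. R (x, t *\<^sub>R \<xi>))"
  have U: "open U" "x \<in> U" and F0: "\<And>y. y \<in> M \<inter> U \<Longrightarrow> F i y = 0"
    and dF: "GDERIV (F i) x :> G i x"
    using L i unfolding local_defining_map_def by auto
  have R0: "R (x, 0) = x"
    and dR: "((\<lambda>\<xi>. R (x, \<xi>)) has_derivative (\<lambda>\<xi>. \<xi>)) (at 0 within tangent_space M x)"
    using R x unfolding retraction_on_def by auto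
  have \<gamma>M: "\<gamma> t \<in> M" for t
    using R x tangent_space_scaleR[OF \<xi>, of t]
    unfolding retraction_on_def tangent_bundle_def \<gamma>_def by blast
  have \<gamma>0: "\<gamma> 0 = x" by (simp add: \<gamma>_def R0)
  have "((\<lambda>t. t *\<^sub>R \<xi>) has_derivative (\<lambda>t. t *\<^sub>R \<xi>)) (at (0::real))"
    by (auto intro!: derivative_eq_intros)
  \<comment> \<open>\<open>R (x, _)\<close> is differentiable only within the tangent space. That
    space contains the whole line through \<xi>, so restricting to this line makes the curve
    \<gamma> differentiable at 0 in the full sense.\<close>
  moreover have "((\<lambda>\<xi>. R (x, \<xi>)) has_derivative (\<lambda>\<xi>. \<xi>))
      (at ((0::real) *\<^sub>R \<xi>) within range (\<lambda>t. t *\<^sub>R \<xi>))"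
    using has_derivative_subset[OF dR, of "range (\<lambda>t. t *\<^sub>R \<xi>)"] tangent_space_scaleR[OF \<xi>]
    by auto
  ultimately have d\<gamma>: "(\<gamma> has_derivative (\<lambda>t. t *\<^sub>R \<xi>)) (at 0)"
    using diff_chain_within[of "\<lambda>t. t *\<^sub>R \<xi>" "\<lambda>t. t *\<^sub>R \<xi>" 0 UNIV "\<lambda>\<xi>. R (x, \<xi>)" "\<lambda>\<xi>. \<xi>"]
    by (simp add: \<gamma>_def o_def)
  have "(F i has_derivative (\<lambda>h. h \<bullet> G i x)) (at (\<gamma> 0))"
    using dF unfolding gderiv_def \<gamma>0 by (simp add: inner_commute)
  from diff_chain_at[OF d\<gamma> this]
  have d: "((\<lambda>t. F i (\<gamma> t)) has_derivative (\<lambda>t. t *\<^sub>R \<xi> \<bullet> G i x)) (at 0)"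
    by (simp add: o_def)
  have "isCont \<gamma> 0" using d\<gamma> has_derivative_continuous by blast
  then have "\<gamma> \<midarrow>0\<rightarrow> x" by (simp add: isCont_def \<gamma>0)
  then have "eventually (\<lambda>t. \<gamma> t \<in> U) (at 0)"
    using U topological_tendstoD by blast
  then have "eventually (\<lambda>t. F i (\<gamma> t) = 0) (at 0)"
    by eventually_elim (use \<gamma>M F0 in auto)
  moreover have "F i (\<gamma> 0) = 0" using F0 U x \<gamma>0 by auto
  ultimately have "((\<lambda>t. 0) has_derivative (\<lambda>t. t *\<^sub>R \<xi> \<bullet> G i x)) (at (0::real))"
    using has_derivative_transform_eventually[OF d, of "\<lambda>_. 0"] by auto
  then have "(\<lambda>t::real. t *\<^sub>R \<xi> \<bullet> G i x) = (\<lambda>t. 0)"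
    by (rule has_derivative_unique) simp
  from fun_cong[OF this, of 1] show ?thesis by (simp add: inner_commute)
qed

text \<open>Replaces the existential over defining maps by one fixed map, which makes the tangent
  space visibly a subspace.\<close>

lemma tangent_space_eq_kernel:
  assumes "retraction_on M R" "x \<in> M" "local_defining_map M x m U F G"
  shows "tangent_space M x = {\<xi>. \<forall>i<m. G i x \<bullet> \<xi> = 0}"
proof
  show "tangent_space M x \<subseteq> {\<xi>. \<forall>i<m. G i x \<bullet> \<xi> = 0}"
    using tangent_space_inner_gradient[OF assms] by blast
  show "{\<xi>. \<forall>i<m. G i x \<bullet> \<xi> = 0} \<subseteq> tangent_space M x"
    unfolding tangent_space_def using assms(3) by blast
qed

section \<open>Orthogonality in linear subspaces\<close>

text \<open>The variational inequality of the projection, tested at the projected point plus and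
  minus \<xi>, bounds the inner product from both sides.\<close>

lemma subspace_closest_point_residual:
  fixes S :: "'a::euclidean_space set"
  assumes "subspace S" "\<xi> \<in> S"
  shows "(v - closest_point S v) \<bullet> \<xi> = 0"
proof -
  let ?p = "closest_point S v"
  have S: "convex S" "closed S" "S \<noteq> {}"
    using assms by (auto simp: subspace_imp_convex closed_subspace)
  have p: "?p \<in> S" using S by (simp add: closest_point_in_set)
  have "(v - ?p) \<bullet> (y - ?p) \<le> 0" if "y \<in> S" for y
    using closest_point_dot[OF S(1,2) that] .
  from this[of "?p + \<xi>"] this[of "?p - \<xi>"] show ?thesis
    using assms p by (simp add: subspace_add subspace_diff)
qed

text \<open>The component of \<open>v\<close> orthogonal to \<open>span S\<close> lies in the common
  kernel, so it is orthogonal to \<open>v\<close> and hence to itself.\<close>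

lemma orthogonal_kernel_in_span:
  fixes S :: "'a::euclidean_space set"
  assumes "\<And>\<xi>. (\<forall>g\<in>S. g \<bullet> \<xi> = 0) \<Longrightarrow> v \<bullet> \<xi> = 0"
  shows "v \<in> span S"
proof -
  obtain y z where y: "y \<in> span S" and z: "\<And>u. u \<in> span S \<Longrightarrow> orthogonal z u" and v: "v = y + z"
    using orthogonal_subspace_decomp_exists[of S v] by metis
  have "v \<bullet> z = 0"
    using assms[of z] z span_base unfolding orthogonal_def by (metis inner_commute)
  moreover have "y \<bullet> z = 0" using z[OF y] by (simp add: orthogonal_def inner_commute)
  ultimately have "z = 0" by (simp add: v inner_add_left)
  with y v show ?thesis by simp
qed

section \<open>Subdifferentials of \<phi> plus the indicator of \<open>M\<close>\<close>

text \<open>Off \<open>M\<close> the difference quotient is infinite and never violates a lower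
  bound, so only the filter within \<open>M\<close> matters. This real-valued \<epsilon> form is the
  one used for estimates.\<close>

lemma frechet_subdifferential_plus_indicator:
  "u \<in> frechet_subdifferential (plus_indicator \<phi> M) y \<longleftrightarrow>
    y \<in> M \<and> (\<forall>\<epsilon>>0. eventually (\<lambda>z. - \<epsilon> * norm (z - y) \<le> \<phi> z - \<phi> y - u \<bullet> (z - y)) (at y within M))"
proof (cases "y \<in> M")
  case False
  then show ?thesis by (simp add: frechet_subdifferential_def plus_indicator_def)
next
  case True
  define q where "q = (\<lambda>z. (plus_indicator \<phi> M z - plus_indicator \<phi> M y - ereal (u \<bullet> (z - y)))
    / ereal (norm (z - y)))"
  have q: "q z = (if z \<in> M then ereal ((\<phi> z - \<phi> y - u \<bullet> (z - y)) / norm (z - y)) else \<infinity>)"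
    if "z \<noteq> y" for z
    using that True by (simp add: q_def plus_indicator_def ereal_divide)
  have A: "ereal (-\<epsilon>) < q z \<longleftrightarrow> (z \<in> M \<longrightarrow> - \<epsilon> * norm (z - y) < \<phi> z - \<phi> y - u \<bullet> (z - y))"
    if "z \<noteq> y" for z \<epsilon>
    using that by (simp add: q pos_less_divide_eq)
  have "0 \<le> Liminf (at y) q \<longleftrightarrow> (\<forall>\<epsilon>>0. eventually (\<lambda>z. ereal (-\<epsilon>) < q z) (at y))"
  proof (safe)
    fix \<epsilon> :: real assume "0 \<le> Liminf (at y) q" "\<epsilon> > 0"
    then show "eventually (\<lambda>z. ereal (-\<epsilon>) < q z) (at y)"
      unfolding le_Liminf_iff by auto
  next
    assume H: "\<forall>\<epsilon>>0. eventually (\<lambda>z. ereal (-\<epsilon>) < q z) (at y)"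
    show "0 \<le> Liminf (at y) q"
      unfolding le_Liminf_iff
    proof safe
      \<comment> \<open>Density supplies a real number between \<open>c\<close> and 0, which also
        covers the case of \<open>c\<close> being minus infinity.\<close>
      fix c :: ereal assume "c < 0"
      then obtain e where "c < ereal e" "ereal e < 0"
        using ereal_dense2 by blast
      with H[rule_format, of "-e"] show "eventually (\<lambda>z. c < q z) (at y)"
        by (auto elim!: eventually_mono)
    qed
  qed
  also have "\<dots> \<longleftrightarrow> (\<forall>\<epsilon>>0. eventually (\<lambda>z. - \<epsilon> * norm (z - y) < \<phi> z - \<phi> y - u \<bullet> (z - y)) (at y within M))"
  proof -
    have "eventually (\<lambda>z. ereal (-\<epsilon>) < q z) (at y) \<longleftrightarrow>
      eventually (\<lambda>z. - \<epsilon> * norm (z - y) < \<phi> z - \<phi> y - u \<bullet> (z - y)) (at y within M)" for \<epsilon>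
      unfolding eventually_at_filter by (intro arg_cong[of _ _ "\<lambda>P. eventually P _"] ext) (use A in auto)
    then show ?thesis by simp
  qed
  also have "\<dots> \<longleftrightarrow> (\<forall>\<epsilon>>0. eventually (\<lambda>z. - \<epsilon> * norm (z - y) \<le> \<phi> z - \<phi> y - u \<bullet> (z - y)) (at y within M))"
  proof safe
    fix \<epsilon> :: real
    assume "\<epsilon> > 0" "\<forall>\<epsilon>>0. eventually (\<lambda>z. - \<epsilon> * norm (z - y) < \<phi> z - \<phi> y - u \<bullet> (z - y)) (at y within M)"
    then show "eventually (\<lambda>z. - \<epsilon> * norm (z - y) \<le> \<phi> z - \<phi> y - u \<bullet> (z - y)) (at y within M)"
      by (auto elim!: allE[of _ \<epsilon>] eventually_mono)
  next
    fix \<epsilon> :: real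
    assume e: "\<epsilon> > 0" and H: "\<forall>\<epsilon>>0. eventually (\<lambda>z. - \<epsilon> * norm (z - y) \<le> \<phi> z - \<phi> y - u \<bullet> (z - y)) (at y within M)"
    \<comment> \<open>Strictness is recovered from the weak inequality for \<epsilon>/2, since
      \<open>norm (z - y)\<close> is positive on the punctured filter.\<close>
    have "eventually (\<lambda>z. z \<noteq> y) (at y within M)" by (simp add: eventually_at_filter)
    moreover have "eventually (\<lambda>z. - (\<epsilon>/2) * norm (z - y) \<le> \<phi> z - \<phi> y - u \<bullet> (z - y)) (at y within M)"
      using H e half_gt_zero by blast
    ultimately show "eventually (\<lambda>z. - \<epsilon> * norm (z - y) < \<phi> z - \<phi> y - u \<bullet> (z - y)) (at y within M)"
    proof eventually_elim
      case (elim z)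
      then have "0 < \<epsilon> * norm (z - y)" using e by simp
      with elim show ?case by (simp add: field_simps)
    qed
  qed
  finally show ?thesis
    using True unfolding frechet_subdifferential_def q_def by (simp add: plus_indicator_def)
qed

text \<open>Points carrying a regular subgradient lie in \<open>M\<close>, where \<phi> is
  continuous, so convergence of the function values is automatic. What remains is a closure of a
  graph, and closedness under limits then needs no diagonal sequence.\<close>

lemma limiting_subdifferential_plus_indicator:
  assumes "continuous_on M \<phi>"
  shows "v \<in> limiting_subdifferential (plus_indicator \<phi> M) x \<longleftrightarrow>
    x \<in> M \<and> (x, v) \<in> closure {(y, u). u \<in> frechet_subdifferential (plus_indicator \<phi> M) y}"
    (is "_ \<longleftrightarrow> _ \<and> _ \<in> closure ?G")
proof (cases "x \<in> M")
  case False
  then show ?thesis by (simp add: limiting_subdifferential_def plus_indicator_def)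
next
  case True
  show ?thesis
  proof
    assume "v \<in> limiting_subdifferential (plus_indicator \<phi> M) x"
    then obtain y u where yu: "\<And>k::nat. u k \<in> frechet_subdifferential (plus_indicator \<phi> M) (y k)"
      "y \<longlonglongrightarrow> x" "u \<longlonglongrightarrow> v"
      unfolding limiting_subdifferential_def by auto
    have "(\<lambda>k. (y k, u k)) \<longlonglongrightarrow> (x, v)" by (intro tendsto_Pair yu)
    then show "x \<in> M \<and> (x, v) \<in> closure ?G"
      unfolding closure_sequential using True yu(1)
      by (intro conjI exI[of _ "\<lambda>k. (y k, u k)"]) auto
  next
    assume "x \<in> M \<and> (x, v) \<in> closure ?G"
    then obtain h where h: "\<And>k::nat. h k \<in> ?G" "h \<longlonglongrightarrow> (x, v)"
      unfolding closure_sequential by blast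
    define y u where "y = fst \<circ> h" and "u = snd \<circ> h"
    have u: "u k \<in> frechet_subdifferential (plus_indicator \<phi> M) (y k)" for k
      using h(1)[of k] by (auto simp: y_def u_def split: prod.splits)
    have lim: "y \<longlonglongrightarrow> x" "u \<longlonglongrightarrow> v"
      using tendsto_fst[OF h(2)] tendsto_snd[OF h(2)] by (auto simp: y_def u_def o_def)
    have yM: "y k \<in> M" for k using u[of k] by (simp add: frechet_subdifferential_plus_indicator)
    have "(\<lambda>k. \<phi> (y k)) \<longlonglongrightarrow> \<phi> x"
      using assms lim(1) True yM by (auto simp: continuous_on_sequentially o_def)
    then have "(\<lambda>k. plus_indicator \<phi> M (y k)) \<longlonglongrightarrow> plus_indicator \<phi> M x"
      using True yM by (simp add: plus_indicator_def)
    then show "v \<in> limiting_subdifferential (plus_indicator \<phi> M) x"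
      unfolding limiting_subdifferential_def mem_Collect_eq using u lim True
      by (intro conjI exI[of _ y] exI[of _ u]) (auto simp: plus_indicator_def)
  qed
qed

lemma limiting_subdifferential_closed_graph:
  assumes "continuous_on M \<phi>" "z \<in> M"
    and "\<And>k. w k \<in> limiting_subdifferential (plus_indicator \<phi> M) (x k)"
    and "x \<longlonglongrightarrow> z" "w \<longlonglongrightarrow> v"
  shows "v \<in> limiting_subdifferential (plus_indicator \<phi> M) z"
proof -
  have "(\<lambda>k. (x k, w k)) \<longlonglongrightarrow> (z, v)" by (intro tendsto_Pair assms)
  then have "(z, v) \<in> closure {(y, u). u \<in> frechet_subdifferential (plus_indicator \<phi> M) y}"
    by (rule closed_sequentially[OF closed_closure, rotated])
      (use assms(3) in \<open>simp add: limiting_subdifferential_plus_indicator[OF assms(1)]\<close>)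
  with assms(2) show ?thesis by (simp add: limiting_subdifferential_plus_indicator[OF assms(1)])
qed

section \<open>Removing the normal part of a subgradient\<close>

text \<open>Keeping the coefficients of \<open>v\<close> in the gradients at \<open>x\<close> fixed,
  the same combination of the \<open>F i\<close> gives \<open>f\<close> and that of the
  \<open>G i\<close> gives its gradient \<open>N\<close>; induction over the span builds both
  together.\<close>

lemma normal_vector_field:
  assumes L: "local_defining_map M x m U F G"
    and v: "v \<in> span ((\<lambda>i. G i x) ` {..<m})"
  obtains f N where "N x = v" "continuous_on U N" "\<And>y. y \<in> U \<Longrightarrow> GDERIV f y :> N y"
    "\<And>y. y \<in> M \<inter> U \<Longrightarrow> f y = 0"
proof -
  have "\<exists>f N. N x = v \<and> continuous_on U N \<and> (\<forall>y\<in>U. GDERIV f y :> N y) \<and> (\<forall>y\<in>M \<inter> U. f y = 0)"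
    using v
  proof (induction rule: span_induct_alt)
    case base
    show ?case by (intro exI[of _ "\<lambda>_. 0"]) (auto simp: GDERIV_const)
  next
    case (step c g h)
    then obtain i f N where i: "i < m" "g = G i x" and fN: "N x = h" "continuous_on U N"
      "\<And>y. y \<in> U \<Longrightarrow> GDERIV f y :> N y" "\<And>y. y \<in> M \<inter> U \<Longrightarrow> f y = 0" by blast
    have G: "continuous_on U (G i)" "\<And>y. y \<in> U \<Longrightarrow> GDERIV (F i) y :> G i y"
      "\<And>y. y \<in> M \<inter> U \<Longrightarrow> F i y = 0"
      using L i unfolding local_defining_map_def by auto
    have "GDERIV (\<lambda>y. c * F i y + f y) y :> c *\<^sub>R G i y + N y" if "y \<in> U" for y
      using GDERIV_add[OF GDERIV_mult[OF GDERIV_const[of c] G(2)[OF that]] fN(3)[OF that]] by simp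
    then show ?case
      using i fN G by (intro exI[of _ "\<lambda>y. c * F i y + f y"] exI[of _ "\<lambda>y. c *\<^sub>R G i y + N y"])
        (auto intro!: continuous_intros)
  qed
  with that show thesis by blast
qed

text \<open>Along \<open>M\<close> the function \<open>f\<close> vanishes, so its linear part
  \<open>v \<bullet> (z - y)\<close> is o(\<open>norm (z - y)\<close>) there. Half of \<epsilon>
  pays for this error and half for the subgradient inequality of \<open>u\<close>.\<close>

lemma frechet_subdifferential_diff_normal:
  assumes u: "u \<in> frechet_subdifferential (plus_indicator \<phi> M) y"
    and U: "open U" "y \<in> U" and f: "GDERIV f y :> v" "\<And>z. z \<in> M \<inter> U \<Longrightarrow> f z = 0"
  shows "u - v \<in> frechet_subdifferential (plus_indicator \<phi> M) y"
  unfolding frechet_subdifferential_plus_indicator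
proof (intro conjI allI impI)
  show y: "y \<in> M" using u by (simp add: frechet_subdifferential_plus_indicator)
  fix \<epsilon> :: real assume e: "\<epsilon> > 0"
  have 1: "eventually (\<lambda>z. - (\<epsilon>/2) * norm (z - y) \<le> \<phi> z - \<phi> y - u \<bullet> (z - y)) (at y within M)"
    using u e unfolding frechet_subdifferential_plus_indicator
    by (meson half_gt_zero)
  have "(f has_derivative (\<lambda>h. v \<bullet> h)) (at y within M)"
    using f(1) unfolding gderiv_def by (simp add: inner_commute has_derivative_at_withinI)
  then obtain \<delta> where \<delta>: "\<delta> > 0"
    "\<And>z. z \<in> M \<Longrightarrow> norm (z - y) < \<delta> \<Longrightarrow> norm (f z - f y - v \<bullet> (z - y)) \<le> (\<epsilon>/2) * norm (z - y)"
    unfolding has_derivative_within_alt using e by (meson half_gt_zero)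
  have 2: "eventually (\<lambda>z. z \<in> M \<and> norm (z - y) < \<delta>) (at y within M)"
    unfolding eventually_at using \<delta>(1) by (auto simp: dist_norm)
  have 3: "eventually (\<lambda>z. z \<in> U) (at y within M)"
    using U by (rule eventually_at_in_open'[THEN filter_leD[OF at_le[OF subset_UNIV]]])
  from 1 2 3 show "eventually (\<lambda>z. - \<epsilon> * norm (z - y) \<le> \<phi> z - \<phi> y - (u - v) \<bullet> (z - y)) (at y within M)"
  proof eventually_elim
    case (elim z)
    have "f z = 0" "f y = 0" using f(2) elim y U by auto
    with \<delta>(2)[of z] elim have "\<bar>v \<bullet> (z - y)\<bar> \<le> (\<epsilon>/2) * norm (z - y)" by simp
    with elim(1) show ?case by (simp add: inner_diff_left)
  qed
qed

lemma projectional_subdifferential_subset_limiting: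
  assumes M: "embedded_submanifold n M" and R: "retraction_on M R" and \<phi>: "continuous_on M \<phi>"
  shows "projectional_subdifferential M \<phi> x \<subseteq> limiting_subdifferential (plus_indicator \<phi> M) x"
proof
  fix p assume "p \<in> projectional_subdifferential M \<phi> x"
  then obtain v where v: "v \<in> limiting_subdifferential (plus_indicator \<phi> M) x"
    and p: "p = closest_point (tangent_space M x) v"
    unfolding projectional_subdifferential_def by blast
  have x: "x \<in> M" using v by (simp add: limiting_subdifferential_plus_indicator[OF \<phi>])
  obtain m U F G where L: "local_defining_map M x m U F G"
    using embedded_submanifoldE[OF M x] .
  have U: "open U" "x \<in> U" using L by (auto simp: local_defining_map_def)
  note T = tangent_space_eq_kernel[OF R x L]
  have "subspace (tangent_space M x)"
    unfolding T by (auto simp: subspace_def inner_add_right)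
  then have "(v - p) \<bullet> \<xi> = 0" if "\<xi> \<in> tangent_space M x" for \<xi>
    unfolding p using that by (rule subspace_closest_point_residual)
  \<comment> \<open>The part removed by the projection is normal, so it extends to a continuous
    field \<open>N\<close> that can be subtracted from the approximating subgradients.\<close>
  then have "v - p \<in> span ((\<lambda>i. G i x) ` {..<m})"
    by (intro orthogonal_kernel_in_span) (auto simp: T)
  then obtain f N where N: "N x = v - p" "continuous_on U N"
    "\<And>y. y \<in> U \<Longrightarrow> GDERIV f y :> N y" "\<And>y. y \<in> M \<inter> U \<Longrightarrow> f y = 0"
    using normal_vector_field[OF L] by metis
  obtain y u where yu: "\<And>k::nat. u k \<in> frechet_subdifferential (plus_indicator \<phi> M) (y k)"
    "y \<longlonglongrightarrow> x" "u \<longlonglongrightarrow> v"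
    using v unfolding limiting_subdifferential_def by auto
  \<comment> \<open>\<open>N\<close> is controlled only on \<open>U\<close>, so the finitely many
    leading terms outside \<open>U\<close> are dropped.\<close>
  obtain k0 where k0: "\<And>k. k \<ge> k0 \<Longrightarrow> y k \<in> U"
    using topological_tendstoD[OF yu(2) U] unfolding eventually_sequentially by blast
  define y' u' where "y' = (\<lambda>k. y (k + k0))" and "u' = (\<lambda>k. u (k + k0))"
  have lim: "y' \<longlonglongrightarrow> x" "u' \<longlonglongrightarrow> v"
    using LIMSEQ_ignore_initial_segment yu unfolding y'_def u'_def by blast+
  have y': "y' k \<in> U" for k using k0 by (simp add: y'_def)
  have "(\<lambda>k. N (y' k)) \<longlonglongrightarrow> N x"
    using N(2) lim(1) U y' by (auto simp: continuous_on_sequentially o_def)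
  then have "(\<lambda>k. u' k - N (y' k)) \<longlonglongrightarrow> p"
    using tendsto_diff[OF lim(2)] N(1) by fastforce
  then have "(\<lambda>k. (y' k, u' k - N (y' k))) \<longlonglongrightarrow> (x, p)"
    by (intro tendsto_Pair lim)
  moreover have "u' k - N (y' k) \<in> frechet_subdifferential (plus_indicator \<phi> M) (y' k)" for k
    using frechet_subdifferential_diff_normal[OF _ U(1) y' N(3)[OF y'] N(4)] yu(1)
    by (simp add: u'_def y'_def)
  ultimately show "p \<in> limiting_subdifferential (plus_indicator \<phi> M) x"
    unfolding limiting_subdifferential_plus_indicator[OF \<phi>] closure_sequential
    using x by (auto intro!: exI[of _ "\<lambda>k. (y' k, u' k - N (y' k))"])
qed

text \<open>The closed graph puts 0 into the limiting subdifferential at \<open>z\<close>; being a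
  tangent vector, 0 is its own projection.\<close>

lemma stationary_point_of_limit:
  assumes M: "embedded_submanifold n M" and R: "retraction_on M R" and \<phi>: "continuous_on M \<phi>"
    and z: "z \<in> M" and w: "\<And>k. w k \<in> projectional_subdifferential M \<phi> (x k)"
    and lim: "x \<longlonglongrightarrow> z" "w \<longlonglongrightarrow> 0"
  shows "stationary_point M \<phi> z"
proof -
  have "0 \<in> limiting_subdifferential (plus_indicator \<phi> M) z"
    using projectional_subdifferential_subset_limiting[OF M R \<phi>] w
    by (intro limiting_subdifferential_closed_graph[OF \<phi> z _ lim]) blast
  moreover have "closest_point (tangent_space M z) 0 = 0"
    using zero_in_tangent_space[OF M z] by (rule closest_point_self)
  ultimately show ?thesis
    using z unfolding stationary_point_def projectional_subdifferential_def by force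
qed

section \<open>Termination of the line search and lower bounds on stepsizes\<close>

text \<open>The trial stepsizes are \<open>\<beta> ^ l * t0\<close> and eventually fall below
  \<open>c\<close>.\<close>

lemma line_search_not_None:
  assumes c: "0 < c" and \<beta>: "0 < \<beta>" "\<beta> < 1" and t0: "0 < t0"
    and acc: "\<And>t. 0 < t \<Longrightarrow> t \<le> c \<Longrightarrow> \<phi> (R (x, t *\<^sub>R d)) \<le> r + \<sigma> * t * (w \<bullet> d)"
  shows "line_search R \<phi> \<sigma> \<beta> x w d r t0 \<noteq> None"
proof -
  have pow: "((\<lambda>t. \<beta> * t) ^^ l) t0 = \<beta> ^ l * t0" for l
    by (induction l) auto
  obtain l where "\<beta> ^ l < c / t0"
    using real_arch_pow_inv[of "c / t0" \<beta>] c t0 \<beta> by auto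
  then have "\<beta> ^ l * t0 \<le> c" using t0 by (simp add: field_simps)
  then have "\<phi> (R (x, (\<beta> ^ l * t0) *\<^sub>R d)) \<le> r + \<sigma> * (\<beta> ^ l * t0) * (w \<bullet> d)"
    using acc[of "\<beta> ^ l * t0"] \<beta> t0 by simp
  then have "\<exists>l. \<not> \<phi> (R (x, ((\<lambda>t. \<beta> * t) ^^ l) t0 *\<^sub>R d)) > r + \<sigma> * ((\<lambda>t. \<beta> * t) ^^ l) t0 * (w \<bullet> d)"
    unfolding pow by (auto simp: not_less)
  then show ?thesis unfolding line_search_def while_option_def by simp
qed

lemma line_search_accepts:
  assumes "line_search R \<phi> \<sigma> \<beta> x w d r t0 = Some t"
  shows "\<phi> (R (x, t *\<^sub>R d)) \<le> r + \<sigma> * t * (w \<bullet> d)"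
  using while_option_stop[OF assms[unfolded line_search_def]] by simp

text \<open>The conclusion is a loop invariant: a rejected trial exceeds \<open>c\<close>, so its
  successor still exceeds \<open>\<beta> * c\<close>.\<close>

lemma line_search_ge:
  assumes ls: "line_search R \<phi> \<sigma> \<beta> x w d r t0 = Some t"
    and \<beta>: "0 < \<beta>" and t0: "0 < t0"
    and acc: "\<And>t. 0 < t \<Longrightarrow> t \<le> c \<Longrightarrow> \<phi> (R (x, t *\<^sub>R d)) \<le> r + \<sigma> * t * (w \<bullet> d)"
  shows "0 < t" "min t0 (\<beta> * c) \<le> t"
proof -
  have "0 < t \<and> min t0 (\<beta> * c) \<le> t"
  proof (rule while_option_rule[OF _ ls[unfolded line_search_def]])
    fix t assume t: "0 < t \<and> min t0 (\<beta> * c) \<le> t" "r + \<sigma> * t * (w \<bullet> d) < \<phi> (R (x, t *\<^sub>R d))"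
    then have "c < t" using acc[of t] by force
    then show "0 < \<beta> * t \<and> min t0 (\<beta> * c) \<le> \<beta> * t"
      using \<beta> t by (simp add: min_le_iff_disj)
  qed (use t0 in auto)
  then show "0 < t" "min t0 (\<beta> * c) \<le> t" by auto
qed

text \<open>The threshold \<open>c\<close> depends only on the neighborhood, not on the point,
  subgradient, direction or reference value. Hence the same fact yields termination of each search
  and a local lower bound on all accepted stepsizes.\<close>

lemma armijo_locally_uniform:
  assumes lb: "locally_bounded_on M S"
    and desc: "\<forall>xb\<in>M. \<exists>\<kappa>>0. \<exists>\<rho>>0. \<exists>V. openin (top_of_set M) V \<and> xb \<in> V \<and>
          (\<forall>y\<in>V. \<forall>\<xi>\<in>tangent_space M y. norm \<xi> \<le> \<rho> \<longrightarrow>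
            (\<forall>v\<in>S y. \<phi> (R (y, \<xi>)) - (\<phi> y + v \<bullet> \<xi>) \<le> \<kappa> * (norm \<xi>)\<^sup>2))"
    and \<sigma>: "\<sigma> < (1::real)" and a: "0 < (a::real)" and z: "z \<in> M"
  obtains c V where "0 < (c::real)" "open V" "z \<in> V"
    "\<And>y w d r t. \<lbrakk>y \<in> M \<inter> V; w \<in> S y; d \<in> tangent_space M y; w \<bullet> d \<le> - a * (norm d)\<^sup>2;
       \<phi> y \<le> r; 0 < t; t \<le> c\<rbrakk> \<Longrightarrow> \<phi> (R (y, t *\<^sub>R d)) \<le> r + \<sigma> * t * (w \<bullet> d)"
proof -
  obtain \<kappa> \<rho> V where \<kappa>: "\<kappa> > 0" and \<rho>: "\<rho> > 0" and V: "openin (top_of_set M) V" "z \<in> V"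
    and D: "\<forall>y\<in>V. \<forall>\<xi>\<in>tangent_space M y. norm \<xi> \<le> \<rho> \<longrightarrow>
      (\<forall>v\<in>S y. \<phi> (R (y, \<xi>)) - (\<phi> y + v \<bullet> \<xi>) \<le> \<kappa> * (norm \<xi>)\<^sup>2)"
    using bspec[OF desc z] by (elim exE conjE) (rule that)
  obtain W where W: "openin (top_of_set M) W" "z \<in> W" "bounded (\<Union>y\<in>W. S y)"
    using lb z unfolding locally_bounded_on_def by blast
  obtain B where B: "B > 0" "\<And>y v. y \<in> W \<Longrightarrow> v \<in> S y \<Longrightarrow> norm v \<le> B"
    using W(3) unfolding bounded_pos by auto
  obtain V' where V': "open V'" "V \<inter> W = M \<inter> V'"
    using openin_Int[OF V(1) W(1)] unfolding openin_open by auto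
  \<comment> \<open>The first bound keeps \<open>t *\<^sub>R d\<close> within radius \<rho>, using
    \<open>a * norm d \<le> B\<close>. The second makes the quadratic error at most the fraction
    \<open>1 - \<sigma>\<close> of the linear decrease.\<close>
  define c where "c = min (\<rho> * a / B) ((1 - \<sigma>) * a / \<kappa>)"
  show thesis
  proof (rule that[of c V'])
    show "0 < c" using \<kappa> \<rho> B \<sigma> a by (simp add: c_def)
    show "open V'" by fact
    show "z \<in> V'" using V V' W by blast
    fix y w d r and t :: real
    assume y: "y \<in> M \<inter> V'" and w: "w \<in> S y" and d: "d \<in> tangent_space M y"
      and wd: "w \<bullet> d \<le> - a * (norm d)\<^sup>2" and r: "\<phi> y \<le> r" and t: "0 < t" "t \<le> c"
    have yV: "y \<in> V" "y \<in> W" using y V' by auto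
    have "a * (norm d)\<^sup>2 \<le> norm w * norm d"
      using wd Cauchy_Schwarz_ineq2[of w d] by linarith
    also have "\<dots> \<le> B * norm d" using B(2)[OF yV(2) w] by (simp add: mult_right_mono)
    finally have nd: "a * norm d \<le> B" using B(1) by (cases "d = 0") (auto simp: power2_eq_square)
    have "norm (t *\<^sub>R d) \<le> \<rho>"
    proof -
      have "t \<le> \<rho> * a / B" using t by (simp add: c_def)
      then have "t * B \<le> \<rho> * a" using B by (simp add: pos_le_divide_eq)
      moreover have "t * (a * norm d) \<le> t * B" using nd t by (simp add: mult_left_mono)
      ultimately have "a * (t * norm d) \<le> a * \<rho>" by (simp add: algebra_simps)
      then show ?thesis using a t by simp
    qed
    from D[rule_format, OF yV(1) tangent_space_scaleR[OF d] this w]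
    have "\<phi> (R (y, t *\<^sub>R d)) \<le> \<phi> y + t * (w \<bullet> d) + t * (\<kappa> * t * (norm d)\<^sup>2)"
      by (simp add: power_mult_distrib power2_eq_square algebra_simps)
    moreover have "\<kappa> * t * (norm d)\<^sup>2 \<le> (1 - \<sigma>) * (a * (norm d)\<^sup>2)"
    proof -
      have "t \<le> (1 - \<sigma>) * a / \<kappa>" using t by (simp add: c_def)
      then have "\<kappa> * t \<le> (1 - \<sigma>) * a" using \<kappa> by (simp add: pos_le_divide_eq mult.commute)
      from mult_right_mono[OF this, of "(norm d)\<^sup>2"] show ?thesis by (simp add: mult.assoc)
    qed
    moreover have "(1 - \<sigma>) * (a * (norm d)\<^sup>2) \<le> (1 - \<sigma>) * (- (w \<bullet> d))"
      using wd \<sigma> by (intro mult_left_mono) auto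
    ultimately have "\<phi> (R (y, t *\<^sub>R d)) \<le> \<phi> y + t * (w \<bullet> d) + t * ((1 - \<sigma>) * (- (w \<bullet> d)))"
      using t by (smt (verit) mult_left_mono)
    with r show "\<phi> (R (y, t *\<^sub>R d)) \<le> r + \<sigma> * t * (w \<bullet> d)"
      by (simp add: algebra_simps)
  qed
qed

section \<open>Uniformity along bounded subsequences and convergence of the method\<close>

text \<open>\<open>M\<close> is not assumed closed; requiring accumulation points to lie in
  \<open>M\<close> is what lets neighborhoods of points of \<open>M\<close> cover the
  closure.\<close>

lemma compact_closure_range_subset:
  fixes x :: "nat \<Rightarrow> 'a::euclidean_space"
  assumes "bounded (range x)" "\<And>k. x k \<in> M" "\<And>z. accumulation_point x z \<Longrightarrow> z \<in> M"
  shows "compact (closure (range x))" "closure (range x) \<subseteq> M"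
proof -
  show "compact (closure (range x))" using assms(1) by (simp add: compact_closure)
  show "closure (range x) \<subseteq> M"
    using assms(2,3) islimpt_range_imp_convergent_subsequence[of _ x]
    by (auto simp: closure_def accumulation_point_def)
qed

theorem theorem3p6:
  fixes M :: "'a::euclidean_space set"
    and n :: nat
    and R :: "'a \<times> 'a \<Rightarrow> 'a"
    and \<phi> :: "'a \<Rightarrow> real"
    and \<tau>min \<tau>max \<sigma> \<beta> pmin a b :: real
    and x w d :: "nat \<Rightarrow> 'a"
    and t0 \<tau> p r :: "nat \<Rightarrow> real"
  assumes "embedded_submanifold n M"
    and "retraction_on M R"
    and "continuous_on M \<phi>"
    and "bdd_below (\<phi> ` M)"
    and "locally_bounded_on M (projectional_subdifferential M \<phi>)"
    and "\<forall>xb\<in>M. \<exists>\<kappa>>0. \<exists>\<rho>>0. \<exists>V. openin (top_of_set M) V \<and> xb \<in> V \<and>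
          (\<forall>y\<in>V. \<forall>\<xi>\<in>tangent_space M y. norm \<xi> \<le> \<rho> \<longrightarrow>
            (\<forall>v\<in>projectional_subdifferential M \<phi> y.
              \<phi> (R (y, \<xi>)) - (\<phi> y + v \<bullet> \<xi>) \<le> \<kappa> * (norm \<xi>)\<^sup>2))"
    and "0 < \<tau>min" and "\<tau>min \<le> \<tau>max"
    and "0 < \<sigma>" and "\<sigma> < 1"
    and "0 < \<beta>" and "\<beta> < 1"
    and "0 < pmin" and "pmin \<le> 1"
    and "0 < a" and "0 < b"
    and "nonmonotone_subgradient_run M R \<phi> \<tau>min \<tau>max \<sigma> \<beta> pmin a b x w d t0 \<tau> p r"
  shows "(\<exists>k. reached R \<phi> \<sigma> \<beta> x w d r t0 k \<and> w k = 0 \<and> stationary_point M \<phi> (x k)) \<or>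
    ((\<forall>k. reached R \<phi> \<sigma> \<beta> x w d r t0 k) \<and>
     (\<forall>s. strict_mono s \<and> bounded (range (x \<circ> s)) \<and>
          (\<forall>z. accumulation_point (x \<circ> s) z \<longrightarrow> z \<in> M) \<longrightarrow>
        (INF j. \<tau> (s j)) > 0 \<and>
        (\<lambda>j. norm (w (s j))) \<longlonglongrightarrow> 0 \<and> (\<lambda>j. norm (d (s j))) \<longlonglongrightarrow> 0) \<and>
     (\<forall>z\<in>M. accumulation_point x z \<longrightarrow> stationary_point M \<phi> z) \<and>
     (\<forall>z\<in>M. accumulation_point x z \<longrightarrow>
        (\<lambda>k. \<phi> (x k)) \<longlonglongrightarrow> \<phi> z \<and> decseq r \<and> r \<longlonglongrightarrow> \<phi> z))"
proof -
  note M = assms(1) and R = assms(2) and \<phi> = assms(3) and bdd = assms(4)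
  let ?S = "projectional_subdifferential M \<phi>"
  let ?rch = "reached R \<phi> \<sigma> \<beta> x w d r t0"
  let ?ls = "\<lambda>k. line_search R \<phi> \<sigma> \<beta> (x k) (w k) (d k) (r k) (t0 k)"
  note near = armijo_locally_uniform[OF assms(5,6) \<open>\<sigma> < 1\<close> \<open>0 < a\<close>]
  have init: "x 0 \<in> M" "r 0 = \<phi> (x 0)"
    and w: "\<And>k. ?rch k \<Longrightarrow> w k \<in> ?S (x k)"
    and d: "\<And>k. ?rch k \<Longrightarrow> w k \<noteq> 0 \<Longrightarrow> d k \<in> tangent_space M (x k) \<and> d k \<noteq> 0 \<and>
        w k \<bullet> d k \<le> - a * (norm (d k))\<^sup>2 \<and> norm (w k) \<le> b * norm (d k) \<and> \<tau>min \<le> t0 k"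
    and upd: "\<And>k t. ?rch k \<Longrightarrow> w k \<noteq> 0 \<Longrightarrow> ?ls k = Some t \<Longrightarrow>
        \<tau> k = t \<and> x (Suc k) = R (x k, \<tau> k *\<^sub>R d k) \<and> pmin \<le> p (Suc k) \<and> p (Suc k) \<le> 1 \<and>
        r (Suc k) = (1 - p (Suc k)) * r k + p (Suc k) * \<phi> (x (Suc k))"
    using assms(17) unfolding nonmonotone_subgradient_run_def by auto
  have rch_Suc: "?rch (Suc k) \<longleftrightarrow> ?rch k \<and> w k \<noteq> 0 \<and> ?ls k \<noteq> None" for k
    unfolding reached_def less_Suc_eq by blast
  have step: "x (Suc k) \<in> M \<and> \<phi> (x (Suc k)) \<le> r k + \<sigma> * \<tau> k * (w k \<bullet> d k) \<and> 0 < \<tau> k \<and>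
      \<phi> (x (Suc k)) \<le> r (Suc k)"
    if k: "?rch (Suc k)" "x k \<in> M" "\<phi> (x k) \<le> r k" for k
  proof -
    obtain t where t: "?ls k = Some t" and rk: "?rch k" "w k \<noteq> 0"
      using k(1) rch_Suc by blast
    note u = upd[OF rk t] and dk = d[OF rk]
    have acc: "\<phi> (x (Suc k)) \<le> r k + \<sigma> * \<tau> k * (w k \<bullet> d k)"
      using line_search_accepts[OF t] u by simp
    \<comment> \<open>With \<open>c\<close> set to 0 the acceptance hypothesis of
      \<open>line_search_ge\<close> is vacuous, and positivity needs nothing more.\<close>
    have pos: "0 < \<tau> k"
      using line_search_ge(1)[OF t \<open>0 < \<beta>\<close>, of 0] dk u \<open>0 < \<tau>min\<close> by simp
    have "x (Suc k) \<in> M"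
      using R k(2) dk u tangent_space_scaleR unfolding retraction_on_def tangent_bundle_def
      by (metis (no_types, lifting) SigmaI image_subset_iff)
    \<comment> \<open>The new reference value is a convex combination of \<open>r k\<close> and
      \<open>\<phi> (x (Suc k))\<close>, and \<open>r k\<close> is no smaller than the
      latter.\<close>
    moreover have "\<phi> (x (Suc k)) \<le> r (Suc k)"
    proof -
      have "w k \<bullet> d k \<le> 0" using dk \<open>0 < a\<close> by (smt (verit) mult_minus_left zero_le_power2 mult_nonneg_nonneg)
      then have "\<sigma> * \<tau> k * (w k \<bullet> d k) \<le> 0" using pos \<open>0 < \<sigma>\<close> by (simp add: mult_nonneg_nonpos)
      then have "\<phi> (x (Suc k)) \<le> r k" using acc by simp
      then have "(1 - p (Suc k)) * \<phi> (x (Suc k)) \<le> (1 - p (Suc k)) * r k"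
        using u by (intro mult_left_mono) auto
      moreover have "r (Suc k) = (1 - p (Suc k)) * r k + p (Suc k) * \<phi> (x (Suc k))"
        using u by blast
      ultimately show ?thesis by (simp add: algebra_simps)
    qed
    ultimately show ?thesis using acc pos by simp
  qed
  have inv: "?rch k \<Longrightarrow> x k \<in> M \<and> \<phi> (x k) \<le> r k" for k
  proof (induction k)
    case 0
    then show ?case using init by simp
  next
    case (Suc k)
    then show ?case using step[of k] rch_Suc by blast
  qed
  show ?thesis
  proof (cases "\<exists>k. ?rch k \<and> w k = 0")
    case True
    then obtain k where "?rch k" "w k = 0" by blast
    then show ?thesis using w[of k] inv[of k] by (auto simp: stationary_point_def)
  next
    case False
    \<comment> \<open>Termination of every line search is proved here: the local threshold at
      \<open>x k\<close> applies because \<open>\<phi> (x k) \<le> r k\<close>.\<close>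
    have rch: "?rch k" for k
    proof (induction k)
      case 0
      show ?case by (simp add: reached_def)
    next
      case (Suc k)
      obtain c V where c: "0 < c" "x k \<in> V" "\<And>y w d r t. \<lbrakk>y \<in> M \<inter> V; w \<in> ?S y; d \<in> tangent_space M y;
         w \<bullet> d \<le> - a * (norm d)\<^sup>2; \<phi> y \<le> r; 0 < t; t \<le> c\<rbrakk>
         \<Longrightarrow> \<phi> (R (y, t *\<^sub>R d)) \<le> r + \<sigma> * t * (w \<bullet> d)"
        using near inv[OF Suc] by metis
      have "w k \<noteq> 0" using False Suc by blast
      note dk = d[OF Suc this]
      have "?ls k \<noteq> None"
        using line_search_not_None[OF c(1) \<open>0 < \<beta>\<close> \<open>\<beta> < 1\<close>, of "t0 k" \<phi> R "x k" "d k" "r k" \<sigma> "w k"]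
          c(2,3) dk inv[OF Suc] w[OF Suc] \<open>0 < \<tau>min\<close> by auto
      with Suc \<open>w k \<noteq> 0\<close> show ?case using rch_Suc by blast
    qed
    have w0: "w k \<noteq> 0" for k using False rch by blast
    have dk: "d k \<in> tangent_space M (x k)" "w k \<bullet> d k \<le> - a * (norm (d k))\<^sup>2"
      "norm (w k) \<le> b * norm (d k)" "\<tau>min \<le> t0 k" for k
      using d[OF rch w0] by auto
    have ls: "?ls k = Some (\<tau> k)" for k
      using rch[of "Suc k"] rch_Suc upd[OF rch w0] by auto
    have xM: "x k \<in> M" and \<phi>r: "\<phi> (x k) \<le> r k" for k using inv rch by auto
    have acc: "\<phi> (x (Suc k)) \<le> r k + \<sigma> * \<tau> k * (w k \<bullet> d k)" and pos: "0 < \<tau> k" for k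
      using step[OF rch xM \<phi>r, of k] by auto
    have p: "pmin \<le> p (Suc k)" "p (Suc k) \<le> 1"
      and rS: "r (Suc k) = (1 - p (Suc k)) * r k + p (Suc k) * \<phi> (x (Suc k))" for k
      using upd[OF rch w0 ls] by auto
    \<comment> \<open>The drop of the reference value equals \<open>p (Suc k)\<close> times the gap
      to the new function value. The gap in turn dominates the step term, so convergence of
      \<open>r\<close> forces both to 0.\<close>
    have decr: "pmin * (r k - \<phi> (x (Suc k))) \<le> r k - r (Suc k)"
      and desc: "\<sigma> * a * (\<tau> k * (norm (d k))\<^sup>2) \<le> r k - \<phi> (x (Suc k))" for k
    proof -
      have "\<sigma> * \<tau> k * (w k \<bullet> d k) \<le> \<sigma> * \<tau> k * (- a * (norm (d k))\<^sup>2)"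
        using dk(2) pos[of k] \<open>0 < \<sigma>\<close> by (intro mult_left_mono) auto
      then show desc: "\<sigma> * a * (\<tau> k * (norm (d k))\<^sup>2) \<le> r k - \<phi> (x (Suc k))"
        using acc[of k] by (simp add: algebra_simps)
      have "0 \<le> \<sigma> * a * (\<tau> k * (norm (d k))\<^sup>2)"
        using pos[of k] \<open>0 < \<sigma>\<close> \<open>0 < a\<close> by simp
      with desc have "0 \<le> r k - \<phi> (x (Suc k))" by simp
      from mult_right_mono[OF p(1)[of k] this]
      show "pmin * (r k - \<phi> (x (Suc k))) \<le> r k - r (Suc k)"
        unfolding rS by (simp add: algebra_simps)
    qed
    have desc0: "0 \<le> r k - \<phi> (x (Suc k))" for k
      using desc[of k] pos[of k] \<open>0 < \<sigma>\<close> \<open>0 < a\<close>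
      by (smt (verit) mult_nonneg_nonneg zero_le_power2)
    have dec: "decseq r"
      unfolding decseq_Suc_iff using decr desc0 \<open>0 < pmin\<close>
      by (smt (verit) mult_nonneg_nonneg)
    obtain m where m: "\<And>k. m \<le> \<phi> (x k)" using bdd xM unfolding bdd_below_def by blast
    \<comment> \<open>\<open>r\<close> is decreasing and bounded below by \<open>m\<close>, because
      it dominates \<phi> along the iterates.\<close>
    obtain l where l: "r \<longlonglongrightarrow> l"
      using decseq_convergent[OF dec, of m] m \<phi>r by (metis order_trans)
    have "(\<lambda>k. r k - r (Suc k)) \<longlonglongrightarrow> l - l"
      by (intro tendsto_diff l LIMSEQ_Suc)
    then have "(\<lambda>k. (r k - r (Suc k)) / pmin) \<longlonglongrightarrow> 0"
      using tendsto_divide_zero by auto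
    then have gap: "(\<lambda>k. r k - \<phi> (x (Suc k))) \<longlonglongrightarrow> 0"
      by (rule tendsto_sandwich[OF _ _ tendsto_const, rotated 2])
        (use desc0 decr \<open>0 < pmin\<close> in \<open>auto simp: field_simps\<close>)
    have "(\<lambda>k. \<phi> (x (Suc k))) \<longlonglongrightarrow> l"
      using tendsto_diff[OF l gap] by simp
    then have lim\<phi>: "(\<lambda>k. \<phi> (x k)) \<longlonglongrightarrow> l" by (rule LIMSEQ_imp_Suc)
    have "(\<lambda>k. (r k - \<phi> (x (Suc k))) / (\<sigma> * a)) \<longlonglongrightarrow> 0"
      using tendsto_divide_zero[OF gap] by auto
    then have \<tau>d: "(\<lambda>k. \<tau> k * (norm (d k))\<^sup>2) \<longlonglongrightarrow> 0"
      by (rule tendsto_sandwich[OF _ _ tendsto_const, rotated 2])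
        (use desc pos \<open>0 < \<sigma>\<close> \<open>0 < a\<close> in \<open>auto simp: field_simps less_imp_le\<close>)

    have loc: "\<exists>c V. 0 < c \<and> open V \<and> z \<in> V \<and> (\<forall>k. x k \<in> V \<longrightarrow> c \<le> \<tau> k)" if z: "z \<in> M" for z
    proof -
      obtain c V where c: "0 < c" "open V" "z \<in> V" "\<And>y w d r t. \<lbrakk>y \<in> M \<inter> V; w \<in> ?S y; d \<in> tangent_space M y;
         w \<bullet> d \<le> - a * (norm d)\<^sup>2; \<phi> y \<le> r; 0 < t; t \<le> c\<rbrakk>
         \<Longrightarrow> \<phi> (R (y, t *\<^sub>R d)) \<le> r + \<sigma> * t * (w \<bullet> d)"
        using near[OF z] by metis
      have "min \<tau>min (\<beta> * c) \<le> \<tau> k" if "x k \<in> V" for k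
        using line_search_ge(2)[OF ls \<open>0 < \<beta>\<close>, of k c] c(4)[of "x k" "w k" "d k" "r k"]
          that dk[of k] \<open>0 < \<tau>min\<close> w[OF rch] xM \<phi>r by auto
      then show ?thesis using c \<open>0 < \<beta>\<close> \<open>0 < \<tau>min\<close>
        by (intro exI[of _ "min \<tau>min (\<beta> * c)"] exI[of _ V]) auto
    qed
    have part1: "(INF j. \<tau> (s j)) > 0 \<and> (\<lambda>j. norm (w (s j))) \<longlonglongrightarrow> 0 \<and> (\<lambda>j. norm (d (s j))) \<longlonglongrightarrow> 0"
      if s: "strict_mono s" "bounded (range (x \<circ> s))" "\<And>z. accumulation_point (x \<circ> s) z \<Longrightarrow> z \<in> M" for s
    proof -
      let ?K = "closure (range (x \<circ> s))"
      have K: "compact ?K" "?K \<subseteq> M"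
        using compact_closure_range_subset[OF s(2) _ s(3)] xM by auto
      \<comment> \<open>A finite subcover of the compact closure turns the local stepsize bounds
        into one positive bound for the subsequence.\<close>
      obtain c V where cV: "\<And>z. z \<in> M \<Longrightarrow> 0 < c z \<and> open (V z) \<and> z \<in> V z \<and> (\<forall>k. x k \<in> V z \<longrightarrow> c z \<le> \<tau> k)"
        using loc by metis
      obtain D where D: "D \<subseteq> ?K" "finite D" "?K \<subseteq> (\<Union>z\<in>D. V z)"
        using compactE_image[OF K(1), of ?K V] cV K(2) by blast
      \<comment> \<open>Inserting 1 keeps the set nonempty, so that \<open>Min\<close> is meaningful
        whatever \<open>D\<close> is.\<close>
      define c0 where "c0 = Min (insert 1 (c ` D))"
      have c0: "0 < c0" using D cV K(2) by (auto simp: c0_def)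
      have low: "c0 \<le> \<tau> (s j)" for j
      proof -
        have "x (s j) \<in> ?K" using closure_subset by fastforce
        then obtain z where z: "z \<in> D" "x (s j) \<in> V z" using D by blast
        then have "c0 \<le> c z" unfolding c0_def using D by (intro Min_le) auto
        also have "c z \<le> \<tau> (s j)" using cV z D K(2) by blast
        finally show ?thesis .
      qed
      have "c0 \<le> (INF j. \<tau> (s j))" by (intro cINF_greatest low) auto
      moreover have d0: "(\<lambda>j. norm (d (s j))) \<longlonglongrightarrow> 0"
      proof -
        have "(\<lambda>j. \<tau> (s j) * (norm (d (s j)))\<^sup>2 / c0) \<longlonglongrightarrow> 0"
          using tendsto_divide_zero[OF LIMSEQ_subseq_LIMSEQ[OF \<tau>d s(1)]] by (simp add: o_def)
        moreover have "(norm (d (s j)))\<^sup>2 \<le> \<tau> (s j) * (norm (d (s j)))\<^sup>2 / c0" for j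
          using mult_right_mono[OF low[of j], of "(norm (d (s j)))\<^sup>2"] c0
          by (simp add: pos_le_divide_eq mult.commute)
        ultimately have "(\<lambda>j. (norm (d (s j)))\<^sup>2) \<longlonglongrightarrow> 0"
          by (elim tendsto_sandwich[OF _ _ tendsto_const, rotated 2]) auto
        from tendsto_real_sqrt[OF this] show ?thesis by simp
      qed
      moreover have "(\<lambda>j. norm (w (s j))) \<longlonglongrightarrow> 0"
      proof -
        have "(\<lambda>j. b * norm (d (s j))) \<longlonglongrightarrow> 0" using tendsto_mult_right_zero[OF d0] .
        then show ?thesis
          by (rule tendsto_sandwich[OF _ _ tendsto_const, rotated 2]) (use dk(3) in auto)
      qed
      ultimately show ?thesis using c0 by auto
    qed
    have part2: "stationary_point M \<phi> z" if z: "z \<in> M" "accumulation_point x z" for z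
    proof -
      obtain s where s: "strict_mono s" "(x \<circ> s) \<longlonglongrightarrow> z"
        using z unfolding accumulation_point_def by blast
      \<comment> \<open>A convergent subsequence is bounded and accumulates only at
        \<open>z\<close>, which lies in \<open>M\<close>, so the first assertion applies to
        it.\<close>
      have "z' = z" if "accumulation_point (x \<circ> s) z'" for z'
        using that s(2) LIMSEQ_subseq_LIMSEQ LIMSEQ_unique unfolding accumulation_point_def by blast
      with z have "(\<lambda>j. norm (w (s j))) \<longlonglongrightarrow> 0"
        using part1[OF s(1) convergent_imp_bounded[OF s(2)]] by blast
      then have "(w \<circ> s) \<longlonglongrightarrow> 0" by (simp add: tendsto_norm_zero_iff o_def)
      then show ?thesis
        using stationary_point_of_limit[OF M R \<phi> z(1) _ s(2), of "w \<circ> s"] w rch by simp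
    qed
    have part3: "(\<lambda>k. \<phi> (x k)) \<longlonglongrightarrow> \<phi> z \<and> decseq r \<and> r \<longlonglongrightarrow> \<phi> z"
      if z: "z \<in> M" "accumulation_point x z" for z
    proof -
      obtain s where s: "strict_mono s" "(x \<circ> s) \<longlonglongrightarrow> z"
        using z unfolding accumulation_point_def by blast
      \<comment> \<open>The limit \<open>l\<close> of the whole sequence is already known to exist;
        the subsequence only identifies it as \<open>\<phi> z\<close>.\<close>
      have "(\<lambda>j. \<phi> (x (s j))) \<longlonglongrightarrow> \<phi> z"
        using \<phi> s(2) z(1) xM by (auto simp: continuous_on_sequentially o_def)
      moreover have "(\<lambda>j. \<phi> (x (s j))) \<longlonglongrightarrow> l"
        using LIMSEQ_subseq_LIMSEQ[OF lim\<phi> s(1)] by (simp add: o_def)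
      ultimately have "\<phi> z = l" by (rule LIMSEQ_unique)
      then show ?thesis using lim\<phi> l dec by simp
    qed
    show ?thesis using rch part1 part2 part3 by blast
  qed
qed

end
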